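(* Let $\mathcal{C}: f_{\mathcal{C}}=0$ be a reduced curve in the complex projective plane and let $k\geq 0$ be an integer. Then $\mathcal{C}$ is of type at most $k$ (i.e. $t(\mathcal{C})\leq k$) if and only if there exists a set $H\subset D(\mathcal{C})$ of homogeneous derivations such that $\mathrm{Indeg}(J(H))=k$.
   Context: $S=\mathbb{C}[x,y,z]$ with its standard grading. $\mathrm{Der}(S)=S\partial_x\oplus S\partial_y\oplus S\partial_z$; a derivation is homogeneous of degree $e$ if its three coefficients are homogeneous of the same degree $e$. For a reduced plane curve $\mathcal{C}: f_{\mathcal{C}}=0$ of degree $d=\deg f_{\mathcal{C}}$, $D(\mathcal{C})=\{\theta\in \mathrm{Der}(S) : \theta(f_{\mathcal{C}})\in f_{\mathcal{C}}S\}$; it always contains $\theta_E=x\partial_x+y\partial_y+z\partial_z$, and $D(\mathcal{C})=D_0(\mathcal{C})\oplus S\theta_E$ with $D_0(\mathcal{C})=\{\theta\in\mathrm{Der}(S):\theta(f_{\mathcal{C}})=0\}$. Let $\{\theta_1=\theta_E,\theta_2,\dots,\theta_r\}$ be a minimal system of homogeneous generators of $D(\mathcal{C})$, of ordered degrees $1=d_1\leq d_2\leq\dots\leq d_r$ (the generalized exponents of $\mathcal{C}$; it is a convention that all the degrees are at least $1$, i.e. $D_0(\mathcal{C})$ has no nonzero element of degree $0$). The type of $\mathcal{C}$ is $t(\mathcal{C})=d_2+d_3-d+1$. For homogeneous $\theta_i,\theta_j,\theta_k\in D(\mathcal{C})$, $M(\theta_i,\theta_j,\theta_k)$ is the $3\times3$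 matrix whose rows are the coefficients of the three derivations with respect to $\partial_x,\partial_y,\partial_z$; its determinant is always divisible by $f_{\mathcal{C}}$, and $g_{ijk}\in S$ is defined by $\det M(\theta_i,\theta_j,\theta_k)=g_{ijk}f_{\mathcal{C}}$. For a set $H\subset D(\mathcal{C})$ of homogeneous derivations, $J(H)$ is the ideal of $S$ generated by all $g_{ijk}$ with $\{\theta_i,\theta_j,\theta_k\}\subset H$. For a homogeneous ideal $I\subset S$, $\mathrm{Indeg}(I)$ (the initial degree) is the minimal degree of a nonzero element of $I$; in particular $\mathrm{Indeg}(J(H))=k$ includes that $J(H)\neq0$. *)

theory Defs
  imports "HOL-Analysis.Analysis" "HOL-Computational_Algebra.Computational_Algebra"
begin

text \<open>
  The ring $S = \mathbf{C}[x,y,z]$ is the iterated polynomial ring $\mathbf{C}[x][y][z]$: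
  the innermost variable is $x$, the outermost one is $z$.
\<close>

type_synonym cpoly3 = "complex poly poly poly"

definition varX :: cpoly3 where "varX = [:[:[:0, 1:]:]:]"
definition varY :: cpoly3 where "varY = [:[:0, 1:]:]"
definition varZ :: cpoly3 where "varZ = [:0, 1:]"

text \<open>The coefficient of $x^a y^b z^c$.\<close>

definition mcoeff :: "cpoly3 \<Rightarrow> nat \<Rightarrow> nat \<Rightarrow> nat \<Rightarrow> complex" where
  "mcoeff p a b c = coeff (coeff (coeff p c) b) a"

text \<open>Only meaningful for nonzero polynomials.\<close>

definition total_degree :: "cpoly3 \<Rightarrow> nat" where
  "total_degree p = Max {a + b + c | a b c. mcoeff p a b c \<noteq> 0}"

text \<open>Zero is homogeneous of every degree.\<close>

definition homogeneous :: "nat \<Rightarrow> cpoly3 \<Rightarrow> bool" where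
  "homogeneous e p \<longleftrightarrow> (\<forall>a b c. mcoeff p a b c \<noteq> 0 \<longrightarrow> a + b + c = e)"

definition partial_x :: "cpoly3 \<Rightarrow> cpoly3" where "partial_x = map_poly (map_poly pderiv)"
definition partial_y :: "cpoly3 \<Rightarrow> cpoly3" where "partial_y = map_poly pderiv"
definition partial_z :: "cpoly3 \<Rightarrow> cpoly3" where "partial_z = pderiv"

text \<open>
  A derivation of $S$ is given by its vector of coefficients with respect to
  $\partial_x, \partial_y, \partial_z$.
\<close>

type_synonym der3 = "cpoly3 ^ 3"

definition der_apply :: "der3 \<Rightarrow> cpoly3 \<Rightarrow> cpoly3" where
  "der_apply \<theta> p = \<theta> $ 1 * partial_x p + \<theta> $ 2 * partial_y p + \<theta> $ 3 * partial_z p"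

definition homogeneous_der :: "nat \<Rightarrow> der3 \<Rightarrow> bool" where
  "homogeneous_der e \<theta> \<longleftrightarrow> (\<forall>i. homogeneous e (\<theta> $ i))"

definition euler_der :: der3 where
  "euler_der = vector [varX, varY, varZ]"

definition reduced_plane_curve :: "cpoly3 \<Rightarrow> bool" where
  "reduced_plane_curve f \<longleftrightarrow> (\<exists>d>0. homogeneous d f) \<and> squarefree f"

definition curve_ders :: "cpoly3 \<Rightarrow> der3 set" where
  "curve_ders f = {\<theta>. f dvd der_apply \<theta> f}"

text \<open>
  The list \<open>ds\<close> is the sequence $d_1 \le \dots \le d_r$ of degrees of a minimal (irredundant)
  system $\theta_1 = \theta_E, \theta_2, \dots, \theta_r$ of homogeneous generators of the
  $S$-module $D(f)$.  As $\theta_E$ comes first, $d_1 = 1$ and all degrees are at least 1;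
  hence there is such a sequence only if $D_0(f)$ has no nonzero element of degree 0.
  The degrees are determined by \<open>\<theta>s\<close>, since irredundancy excludes zero generators.
\<close>

definition generalized_exponents :: "cpoly3 \<Rightarrow> nat list \<Rightarrow> bool" where
  "generalized_exponents f ds \<longleftrightarrow>
     (\<exists>\<theta>s. \<theta>s \<noteq> [] \<and> \<theta>s ! 0 = euler_der \<and> distinct \<theta>s \<and>
       list_all2 homogeneous_der ds \<theta>s \<and> sorted ds \<and>
       module.span (*s) (set \<theta>s) = curve_ders f \<and>
       (\<forall>T. T \<subset> set \<theta>s \<longrightarrow> module.span (*s) T \<noteq> curve_ders f))"

text \<open>
  The type $d_2 + d_3 - d + 1$, where \<open>ds\<close> are the generalized exponents of the curve; list
  indices start at 0, and \<open>ds\<close> always has length at least 3, as $D(f)$ has rank 3.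
\<close>

definition curve_type :: "cpoly3 \<Rightarrow> nat list \<Rightarrow> int" where
  "curve_type f ds = int (ds ! 1) + int (ds ! 2) - int (total_degree f) + 1"

text \<open>The matrix whose rows are the three derivations.\<close>

definition der_matrix :: "der3 \<Rightarrow> der3 \<Rightarrow> der3 \<Rightarrow> cpoly3 ^ 3 ^ 3" where
  "der_matrix \<theta>1 \<theta>2 \<theta>3 = vector [\<theta>1, \<theta>2, \<theta>3]"

text \<open>
  The ideal generated by all $g$ with $\det M(\theta_1,\theta_2,\theta_3) = g f$ for members of
  \<open>H\<close>.  Triples with repetitions only contribute $g = 0$.
\<close>

definition J_ideal :: "cpoly3 \<Rightarrow> der3 set \<Rightarrow> cpoly3 set" where
  "J_ideal f H = module.span (*)
     {g. \<exists>\<theta>1\<in>H. \<exists>\<theta>2\<in>H. \<exists>\<theta>3\<in>H. det (der_matrix \<theta>1 \<theta>2 \<theta>3) = g * f}"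

text \<open>Only meaningful for ideals other than \<open>{0}\<close>.\<close>

definition Indeg :: "cpoly3 set \<Rightarrow> nat" where
  "Indeg I = (LEAST e. \<exists>p\<in>I. p \<noteq> 0 \<and> total_degree p = e)"

end

theory Submission
  imports Defs "HOL-Computational_Algebra.Field_as_Ring"
begin

text \<open>
  Cramer's rule applied to the gradient shows that \<open>f\<close> divides \<open>det M\<close> times each partial
  derivative of \<open>f\<close>, and \<open>f\<close> has no common factor with all its partials since it is squarefree; so
  \<open>f\<close> divides \<open>det M\<close>.

  Homogeneous elements of \<open>D(f)\<close> of degree below $d_{i+1}$ lie in the span of the first $i$
  generators. Hence three independent ones have degrees, in increasing order, at least
  $d_1, d_2, d_3$, so that every nonzero $g_{ijk}$ has degree at least $1 + d_2 + d_3 - d$, which is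
  the type. Conversely $\theta_E, \theta_2, \theta_3$ are independent, their $g$ has degree exactly
  the type $t$, and replacing $\theta_E$ by $x^{k-t}\theta_E$ raises it to $k$.
\<close>

text \<open>Leaves \<open>$\<close> for vector entries only; formal power series use the same symbol
  for coefficients.\<close>

no_notation fps_nth (infixl \<open>$\<close> 75)

text \<open>\<open>vec3\<close> supplies the span calculus for submodules of \<open>S^3\<close>;
  \<open>module_mult\<close> does so for ideals of \<open>S\<close>.\<close>

interpretation vec3: module "(*s) :: 'a::comm_ring_1 \<Rightarrow> 'a^'n \<Rightarrow> 'a^'n"
  by standard (simp_all add: vec_eq_iff algebra_simps)
lemma module_mult: "module ((*) :: 'a::comm_ring_1 \<Rightarrow> 'a \<Rightarrow> 'a)"
  by standard (simp_all add: algebra_simps)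

section \<open>Homogeneous components\<close>

lemma poly3_eqI:
  assumes "\<And>a b c. mcoeff p a b c = mcoeff q a b c"
  shows "p = q"
  using assms by (intro poly_eqI) (simp add: mcoeff_def)

lemma mcoeff_0 [simp]: "mcoeff 0 a b c = 0"
  by (simp add: mcoeff_def)

lemma mcoeff_add [simp]: "mcoeff (p + q) a b c = mcoeff p a b c + mcoeff q a b c"
  by (simp add: mcoeff_def)

lemma mcoeff_minus [simp]: "mcoeff (- p) a b c = - mcoeff p a b c"
  by (simp add: mcoeff_def)

lemma mcoeff_sum: "mcoeff (\<Sum>i\<in>I. p i) a b c = (\<Sum>i\<in>I. mcoeff (p i) a b c)"
  by (simp add: mcoeff_def coeff_sum)

lemma mcoeff_mult:
  "mcoeff (p * q) a b c =
    (\<Sum>k\<le>c. \<Sum>j\<le>b. \<Sum>i\<le>a. mcoeff p i j k * mcoeff q (a - i) (b - j) (c - k))"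
  by (simp add: mcoeff_def coeff_mult coeff_sum)

text \<open>Some term of the convolution must be nonzero. Only the sums of exponents are recorded,
  which is all that degree arguments need.\<close>

lemma mcoeff_mult_nonzeroE:
  assumes "mcoeff (p * q) a b c \<noteq> 0"
  obtains i j k i' j' k' where "mcoeff p i j k \<noteq> 0" "mcoeff q i' j' k' \<noteq> 0"
    "a + b + c = (i + j + k) + (i' + j' + k')"
proof -
  obtain k where k: "k \<le> c"
    "(\<Sum>j\<le>b. \<Sum>i\<le>a. mcoeff p i j k * mcoeff q (a - i) (b - j) (c - k)) \<noteq> 0"
    using assms unfolding mcoeff_mult by (auto elim: sum.not_neutral_contains_not_neutral)
  then obtain j where j: "j \<le> b"
    "(\<Sum>i\<le>a. mcoeff p i j k * mcoeff q (a - i) (b - j) (c - k)) \<noteq> 0"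
    by (auto elim: sum.not_neutral_contains_not_neutral)
  then obtain i where "i \<le> a" "mcoeff p i j k * mcoeff q (a - i) (b - j) (c - k) \<noteq> 0"
    by (auto elim: sum.not_neutral_contains_not_neutral)
  with j k show thesis
    by (intro that[of i j k "a - i" "b - j" "c - k"]) auto
qed

lemma mcoeff_nonzero_ex: "p \<noteq> 0 \<Longrightarrow> \<exists>a b c. mcoeff p a b c \<noteq> 0"
  using poly3_eqI[of p 0] by auto

text \<open>Makes the \<open>Max\<close> in \<open>total_degree\<close> a genuine, attained
  maximum.\<close>

lemma finite_mcoeff_degrees: "finite {a + b + c | a b c. mcoeff p a b c \<noteq> 0}"
proof -
  let ?I = "SIGMA c:{..degree p}. SIGMA b:{..degree (coeff p c)}. {..degree (coeff (coeff p c) b)}"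
  have "{a + b + c | a b c. mcoeff p a b c \<noteq> 0} \<subseteq> (\<lambda>(c, b, a). a + b + c) ` ?I"
  proof clarify
    fix a b c assume "mcoeff p a b c \<noteq> 0"
    then have "coeff (coeff (coeff p c) b) a \<noteq> 0" by (simp add: mcoeff_def)
    moreover from this have "coeff (coeff p c) b \<noteq> 0" by auto
    moreover from this have "coeff p c \<noteq> 0" by auto
    ultimately have "(c, b, a) \<in> ?I" by (auto intro: le_degree)
    then show "a + b + c \<in> (\<lambda>(c, b, a). a + b + c) ` ?I"
      by (intro image_eqI[of _ _ "(c, b, a)"]) auto
  qed
  then show ?thesis by (rule finite_subset) auto
qed

lemma total_degree_attained:
  assumes "p \<noteq> 0"
  obtains a b c where "mcoeff p a b c \<noteq> 0" "total_degree p = a + b + c"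
proof -
  have "{a + b + c | a b c. mcoeff p a b c \<noteq> 0} \<noteq> {}"
    using mcoeff_nonzero_ex[OF assms] by auto
  from Max_in[OF finite_mcoeff_degrees this] show thesis
    using that unfolding total_degree_def by auto
qed

lemma total_degree_homogeneous: "homogeneous e p \<Longrightarrow> p \<noteq> 0 \<Longrightarrow> total_degree p = e"
  using total_degree_attained[of p] unfolding homogeneous_def by metis

lemma homogeneous_0 [simp]: "homogeneous e 0"
  by (simp add: homogeneous_def)

lemma homogeneous_add: "homogeneous e p \<Longrightarrow> homogeneous e q \<Longrightarrow> homogeneous e (p + q)"
  unfolding homogeneous_def mcoeff_add by (metis add.right_neutral)

lemma homogeneous_minus: "homogeneous e p \<Longrightarrow> homogeneous e (- p)"
  unfolding homogeneous_def by simp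

lemma homogeneous_diff: "homogeneous e p \<Longrightarrow> homogeneous e q \<Longrightarrow> homogeneous e (p - q)"
  using homogeneous_add[OF _ homogeneous_minus, of e p q] by simp

lemma homogeneous_mult: "homogeneous d p \<Longrightarrow> homogeneous e q \<Longrightarrow> homogeneous (d + e) (p * q)"
  by (auto simp: homogeneous_def elim!: mcoeff_mult_nonzeroE)

lemma homogeneous_unique: "homogeneous d p \<Longrightarrow> homogeneous e p \<Longrightarrow> p \<noteq> 0 \<Longrightarrow> d = e"
  using total_degree_homogeneous by metis

definition const3 :: "complex \<Rightarrow> cpoly3" where "const3 a = [:[:[:a:]:]:]"

lemma mcoeff_const3: "mcoeff (const3 k) a b c = (if a = 0 \<and> b = 0 \<and> c = 0 then k else 0)"
  by (auto simp: mcoeff_def const3_def coeff_pCons split: nat.splits)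

lemma homogeneous_const3: "homogeneous 0 (const3 k)"
  by (auto simp: homogeneous_def mcoeff_const3)

lemma homogeneous_0_const3: "homogeneous 0 p \<Longrightarrow> p = const3 (mcoeff p 0 0 0)"
  by (rule poly3_eqI) (auto simp: homogeneous_def mcoeff_const3)

lemma const3_mult: "const3 a * const3 b = const3 (a * b)"
  by (simp add: const3_def)

lemma const3_1: "const3 1 = 1"
  by (simp add: const3_def one_pCons)

text \<open>A form of degree 0 is a constant, and nonzero complex numbers are invertible.\<close>

lemma homogeneous_0_is_unit:
  assumes "homogeneous 0 p" "p \<noteq> 0"
  shows "is_unit p"
proof -
  define a where "a = mcoeff p 0 0 0"
  have p: "p = const3 a" using homogeneous_0_const3[OF assms(1)] by (simp add: a_def)
  have "a \<noteq> 0" using p assms(2) by (auto simp: const3_def)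
  then have "1 = p * const3 (inverse a)" by (simp add: p const3_mult const3_1)
  then show ?thesis by (rule dvdI)
qed

text \<open>The exponents of \<open>z\<close> and \<open>y\<close> run freely and that of
  \<open>x\<close> is forced, so the sum is finite. The bounds keep the subtractions from
  truncating.\<close>

definition hom_comp :: "nat \<Rightarrow> cpoly3 \<Rightarrow> cpoly3" where
  "hom_comp e p = (\<Sum>c\<le>e. \<Sum>b\<le>e - c.
     monom (monom (monom (mcoeff p (e - c - b) b c) (e - c - b)) b) c)"

lemma mcoeff_hom_comp:
  "mcoeff (hom_comp e p) a b c = (if a + b + c = e then mcoeff p a b c else 0)"
proof -
  have "mcoeff (hom_comp e p) a b c = (\<Sum>c'\<le>e. \<Sum>b'\<le>e - c'.
     if c' = c then if b' = b then if e - c' - b' = a then mcoeff p a b c else 0 else 0 else 0)"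
    unfolding hom_comp_def mcoeff_sum
    by (intro sum.cong refl) (auto simp: mcoeff_def)
  also have "\<dots> = (\<Sum>c'\<le>e. if c' = c then
     \<Sum>b'\<le>e - c. if b' = b then if e - c - b = a then mcoeff p a b c else 0 else 0 else 0)"
    by (intro sum.cong refl) (auto intro!: sum.cong)
  also have "\<dots> = (if a + b + c = e then mcoeff p a b c else 0)"
    by (auto simp: sum.delta)
  finally show ?thesis .
qed

lemma homogeneous_hom_comp: "homogeneous e (hom_comp e p)"
  by (auto simp: homogeneous_def mcoeff_hom_comp)

lemma hom_comp_eq_0_iff: "hom_comp e p = 0 \<longleftrightarrow> (\<forall>a b c. a + b + c = e \<longrightarrow> mcoeff p a b c = 0)"
  by (metis mcoeff_0 mcoeff_hom_comp poly3_eqI)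

lemma hom_comp_homogeneous: "homogeneous e p \<Longrightarrow> hom_comp e p = p"
  by (rule poly3_eqI) (auto simp: mcoeff_hom_comp homogeneous_def)

lemma hom_comp_homogeneous_other: "homogeneous d p \<Longrightarrow> d \<noteq> e \<Longrightarrow> hom_comp e p = 0"
  by (auto simp: hom_comp_eq_0_iff homogeneous_def)

lemma hom_comp_sum: "hom_comp e (\<Sum>i\<in>I. p i) = (\<Sum>i\<in>I. hom_comp e (p i))"
  by (rule poly3_eqI) (auto simp: mcoeff_hom_comp mcoeff_sum)

lemma hom_comp_nonzero_ex: "p \<noteq> 0 \<Longrightarrow> \<exists>e. hom_comp e p \<noteq> 0"
  by (meson hom_comp_eq_0_iff mcoeff_nonzero_ex)

text \<open>In total degree \<open>d + e\<close>, a term of the convolution with left degree other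
  than \<open>d\<close> has one factor below its order, hence vanishes.\<close>

lemma hom_comp_mult_lowest:
  assumes "\<And>i. i < d \<Longrightarrow> hom_comp i p = 0" "\<And>i. i < e \<Longrightarrow> hom_comp i q = 0"
  shows "hom_comp (d + e) (p * q) = hom_comp d p * hom_comp e q"
proof (rule poly3_eqI)
  fix a b c
  have p0: "mcoeff p i j k = 0" if "i + j + k < d" for i j k
    using assms(1)[OF that] by (auto simp: hom_comp_eq_0_iff)
  have q0: "mcoeff q i j k = 0" if "i + j + k < e" for i j k
    using assms(2)[OF that] by (auto simp: hom_comp_eq_0_iff)
  show "mcoeff (hom_comp (d + e) (p * q)) a b c = mcoeff (hom_comp d p * hom_comp e q) a b c"
  proof (cases "a + b + c = d + e")
    case True
    have "mcoeff p i j k * mcoeff q (a - i) (b - j) (c - k) =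
        mcoeff (hom_comp d p) i j k * mcoeff (hom_comp e q) (a - i) (b - j) (c - k)"
      if "i \<le> a" "j \<le> b" "k \<le> c" for i j k
    proof (cases "i + j + k = d")
      case True
      then have "a - i + (b - j) + (c - k) = e" using \<open>a + b + c = d + e\<close> that by linarith
      with True show ?thesis by (simp add: mcoeff_hom_comp)
    next
      case False
      then have "i + j + k < d \<or> a - i + (b - j) + (c - k) < e"
        using \<open>a + b + c = d + e\<close> that by linarith
      then consider "i + j + k < d" | "a - i + (b - j) + (c - k) < e" by blast
      then show ?thesis using False by cases (auto simp: mcoeff_hom_comp p0 q0)
    qed
    then show ?thesis using True
      by (simp add: mcoeff_hom_comp[of "d + e"] mcoeff_mult)
  next
    case False
    moreover have "homogeneous (d + e) (hom_comp d p * hom_comp e q)"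
      by (intro homogeneous_mult homogeneous_hom_comp)
    ultimately show ?thesis
      by (auto simp: mcoeff_hom_comp homogeneous_def)
  qed
qed

text \<open>Multiplication by a form of degree \<open>d\<close> shifts every component by
  \<open>d\<close>. The case distinction keeps \<open>e - d\<close> from truncating.\<close>

lemma hom_comp_mult_homogeneous:
  assumes "homogeneous d q"
  shows "hom_comp e (p * q) = (if d \<le> e then hom_comp (e - d) p * q else 0)"
proof (rule poly3_eqI)
  fix a b c
  have "mcoeff p i j k * mcoeff q (a - i) (b - j) (c - k) =
      mcoeff (hom_comp (e - d) p) i j k * mcoeff q (a - i) (b - j) (c - k)"
    if "i \<le> a" "j \<le> b" "k \<le> c" "a + b + c = e" for i j k
  proof (cases "mcoeff q (a - i) (b - j) (c - k) = 0")
    case False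
    then have "a - i + (b - j) + (c - k) = d" using assms by (auto simp: homogeneous_def)
    with that have "i + j + k = e - d" by linarith
    then show ?thesis by (simp add: mcoeff_hom_comp)
  qed simp
  then have eq: "mcoeff (p * q) a b c = mcoeff (hom_comp (e - d) p * q) a b c" if "a + b + c = e"
    unfolding mcoeff_mult using that by (intro sum.cong refl) auto
  show "mcoeff (hom_comp e (p * q)) a b c =
      mcoeff (if d \<le> e then hom_comp (e - d) p * q else 0) a b c"
  proof (cases "a + b + c = e")
    case True
    moreover have "mcoeff (p * q) a b c = 0" if "\<not> d \<le> e"
      using assms that True mcoeff_mult_nonzeroE[of p q a b c] unfolding homogeneous_def
      by (metis le_add2)
    ultimately show ?thesis using eq by (simp add: mcoeff_hom_comp[of e "p * q"])
  next
    case False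
    have "homogeneous (e - d + d) (hom_comp (e - d) p * q)"
      by (intro homogeneous_mult homogeneous_hom_comp assms)
    then have "mcoeff (hom_comp (e - d) p * q) a b c = 0" if "d \<le> e"
      using that False by (auto simp: homogeneous_def)
    with False show ?thesis by (simp add: mcoeff_hom_comp[of e "p * q"])
  qed
qed

text \<open>As \<open>S\<close> is a domain, each nonzero component of \<open>g\<close> survives
  multiplication by \<open>f\<close>, so it must sit in degree \<open>N - d\<close>. The form
  \<open>N = m + d\<close> also records \<open>d \<le> N\<close>.\<close>

lemma homogeneous_factor:
  assumes "homogeneous N (g * f)" "homogeneous d f" "f \<noteq> 0" "g \<noteq> 0"
  obtains m where "N = m + d" "homogeneous m g"
proof -
  have *: "m + d = N" if "hom_comp m g \<noteq> 0" for m
  proof (rule ccontr)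
    assume "m + d \<noteq> N"
    then have "hom_comp (m + d) (g * f) = 0"
      using assms(1) hom_comp_homogeneous_other by metis
    then show False
      using hom_comp_mult_homogeneous[OF assms(2), of "m + d" g] that assms(3) by simp
  qed
  obtain m where m: "hom_comp m g \<noteq> 0" using hom_comp_nonzero_ex[OF assms(4)] by blast
  have "homogeneous m g"
    unfolding homogeneous_def
  proof (intro allI impI)
    fix a b c assume "mcoeff g a b c \<noteq> 0"
    then have "hom_comp (a + b + c) g \<noteq> 0" by (auto simp: hom_comp_eq_0_iff)
    from *[OF this] *[OF m] show "a + b + c = m" by simp
  qed
  with *[OF m] that show thesis by metis
qed

section \<open>Partial derivatives\<close>

text \<open>Lifts a derivation of the coefficient ring to polynomials; one lift gives
  \<open>partial_y\<close>, two give \<open>partial_x\<close>.\<close>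

lemma map_poly_derivation:
  fixes D :: "'a::comm_ring_1 \<Rightarrow> 'a"
  assumes "\<And>a b. D (a + b) = D a + D b" "\<And>a b. D (a * b) = D a * b + a * D b"
  shows "map_poly D (p + q) = map_poly D p + map_poly D q"
    and "map_poly D (p * q) = map_poly D p * q + p * map_poly D q"
proof -
  have 0: "D 0 = 0" using assms(1)[of 0 0] by simp
  have sum: "D (sum h I) = (\<Sum>i\<in>I. D (h i))" for h and I :: "nat set"
    by (induction I rule: infinite_finite_induct) (simp_all add: 0 assms(1))
  show "map_poly D (p + q) = map_poly D p + map_poly D q"
    by (rule poly_eqI) (simp add: coeff_map_poly 0 assms(1))
  show "map_poly D (p * q) = map_poly D p * q + p * map_poly D q"
    by (rule poly_eqI) (simp add: coeff_map_poly 0 coeff_mult sum assms(2) sum.distrib)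
qed

text \<open>A polynomial dividing its own derivative has derivative 0, by degree; this passes to
  coefficientwise derivatives because the quotient must then be a constant.\<close>

lemma dvd_pderiv_imp_0:
  fixes p :: "'a::{idom,semiring_char_0} poly"
  assumes "p dvd pderiv p"
  shows "pderiv p = 0"
proof (rule ccontr)
  assume *: "pderiv p \<noteq> 0"
  then have "degree p \<le> degree (pderiv p)" using assms by (intro dvd_imp_degree_le)
  then have "degree p = 0" by (simp add: degree_pderiv)
  then show False using * pderiv_eq_0_iff by blast
qed

lemma dvd_map_poly_imp_0:
  fixes D :: "'a::idom \<Rightarrow> 'a"
  assumes D0: "D 0 = 0" and D: "\<And>a. a dvd D a \<Longrightarrow> D a = 0" and dvd: "p dvd map_poly D p"
  shows "map_poly D p = 0"
proof (rule ccontr)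
  assume nz: "map_poly D p \<noteq> 0"
  from dvd obtain q where q: "map_poly D p = p * q" ..
  with nz have "p \<noteq> 0" "q \<noteq> 0" by auto
  then have "degree p + degree q \<le> degree p"
    using map_poly_degree_leq[of D p] by (simp add: q degree_mult_eq)
  then obtain c where "q = [:c:]" by (auto elim: degree_eq_zeroE)
  then have "D (coeff p n) = coeff p n * c" for n
    using arg_cong[OF q, of "\<lambda>r. coeff r n"] by (simp add: coeff_map_poly D0)
  \<comment> \<open>Each coefficient divides its own image under \<open>D\<close>, so the hypothesis
    on \<open>D\<close> applies to it.\<close>
  then have "D (coeff p n) = 0" for n by (intro D) simp
  then have "map_poly D p = 0" by (intro poly_eqI) (simp add: coeff_map_poly D0)
  with nz show False ..
qed

lemma mcoeff_partial:
  "mcoeff (partial_x p) a b c = of_nat (Suc a) * mcoeff p (Suc a) b c"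
  "mcoeff (partial_y p) a b c = of_nat (Suc b) * mcoeff p a (Suc b) c"
  "mcoeff (partial_z p) a b c = of_nat (Suc c) * mcoeff p a b (Suc c)"
proof -
  have scale: "coeff (of_nat n * q) m = of_nat n * coeff q m" 
    for n m and q :: "'a::comm_semiring_1 poly"
    by (simp add: of_nat_poly)
  show "mcoeff (partial_x p) a b c = of_nat (Suc a) * mcoeff p (Suc a) b c"
    "mcoeff (partial_y p) a b c = of_nat (Suc b) * mcoeff p a (Suc b) c"
    "mcoeff (partial_z p) a b c = of_nat (Suc c) * mcoeff p a b (Suc c)"
    unfolding mcoeff_def partial_x_def partial_y_def partial_z_def
    by (simp_all add: coeff_map_poly coeff_pderiv scale del: of_nat_Suc)
qed

lemma homogeneous_partial:
  assumes "homogeneous (Suc e) p"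
  shows "homogeneous e (partial_x p)" "homogeneous e (partial_y p)" "homogeneous e (partial_z p)"
  using assms by (fastforce simp: homogeneous_def mcoeff_partial simp del: of_nat_Suc)+

lemma partial_mult:
  "partial_x (p * q) = partial_x p * q + p * partial_x q"
  "partial_y (p * q) = partial_y p * q + p * partial_y q"
  "partial_z (p * q) = partial_z p * q + p * partial_z q"
  unfolding partial_x_def partial_y_def partial_z_def
  by (intro map_poly_derivation(2) map_poly_derivation(1) pderiv_add;
      simp add: pderiv_mult algebra_simps)+
    (simp add: pderiv_mult algebra_simps)

lemma dvd_partial_imp_0:
  "p dvd partial_x p \<Longrightarrow> partial_x p = 0"
  "p dvd partial_y p \<Longrightarrow> partial_y p = 0"
  "p dvd partial_z p \<Longrightarrow> partial_z p = 0"
  unfolding partial_x_def partial_y_def partial_z_def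
  by (auto intro!: dvd_map_poly_imp_0 dvd_pderiv_imp_0 intro: dvd_map_poly_imp_0 dvd_pderiv_imp_0)

text \<open>In characteristic 0, a partial derivative multiplies each coefficient with positive
  exponent by a nonzero integer, so no such coefficient survives.\<close>

lemma partial_eq_0_imp_homogeneous:
  assumes "partial_x p = 0" "partial_y p = 0" "partial_z p = 0"
  shows "homogeneous 0 p"
  unfolding homogeneous_def
proof (intro allI impI)
  fix a b c assume nz: "mcoeff p a b c \<noteq> 0"
  have "mcoeff p (Suc i) j k = 0" "mcoeff p i (Suc j) k = 0" "mcoeff p i j (Suc k) = 0" for i j k
    using mcoeff_partial[of p i j k] assms by (simp_all del: of_nat_Suc)
  with nz show "a + b + c = 0" by (cases a; cases b; cases c) auto
qed

section \<open>Euler's formula\<close>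

lemma mcoeff_var_mult:
  "mcoeff (varX * p) a b c = (if a = 0 then 0 else mcoeff p (a - 1) b c)"
  "mcoeff (varY * p) a b c = (if b = 0 then 0 else mcoeff p a (b - 1) c)"
  "mcoeff (varZ * p) a b c = (if c = 0 then 0 else mcoeff p a b (c - 1))"
  unfolding mcoeff_def varX_def varY_def varZ_def
  by (auto simp: coeff_pCons split: nat.splits)

lemma of_nat_const3: "of_nat n = const3 (of_nat n)"
  by (simp add: const3_def of_nat_poly)

lemma mcoeff_of_nat_mult: "mcoeff (of_nat n * p) a b c = of_nat n * mcoeff p a b c"
  by (simp add: of_nat_const3 const3_def mcoeff_def)

text \<open>The Euler derivation multiplies each monomial by its total degree.\<close>

lemma euler_formula:
  assumes "homogeneous d p"
  shows "der_apply euler_der p = of_nat d * p"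
proof (rule poly3_eqI)
  fix a b c
  have "mcoeff (der_apply euler_der p) a b c = of_nat (a + b + c) * mcoeff p a b c"
    unfolding der_apply_def euler_der_def vector_3 mcoeff_add mcoeff_var_mult
    by (cases a; cases b; cases c) (simp_all add: mcoeff_partial algebra_simps)
  also have "\<dots> = mcoeff (of_nat d * p) a b c"
    using assms
    by (cases "mcoeff p a b c = 0") (simp_all add: homogeneous_def mcoeff_of_nat_mult del: of_nat_add)
  finally show "mcoeff (der_apply euler_der p) a b c = mcoeff (of_nat d * p) a b c" .
qed

section \<open>Lower bounds for the initial degree\<close>

text \<open>This is the \<open>m\<close>-th power of the ideal generated by the variables.\<close>

lemma low_order_subspace: "module.subspace (*) {p. \<forall>a b c. mcoeff p a b c \<noteq> 0 \<longrightarrow> m \<le> a + b + c}"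
proof (rule module.subspaceI[OF module_mult])
  fix p q assume "p \<in> {p. \<forall>a b c. mcoeff p a b c \<noteq> 0 \<longrightarrow> m \<le> a + b + c}"
    "q \<in> {p. \<forall>a b c. mcoeff p a b c \<noteq> 0 \<longrightarrow> m \<le> a + b + c}"
  then show "p + q \<in> {p. \<forall>a b c. mcoeff p a b c \<noteq> 0 \<longrightarrow> m \<le> a + b + c}"
    by (simp add: mcoeff_add) (metis add.right_neutral)
next
  fix s p assume p: "p \<in> {p. \<forall>a b c. mcoeff p a b c \<noteq> 0 \<longrightarrow> m \<le> a + b + c}"
  show "s * p \<in> {p. \<forall>a b c. mcoeff p a b c \<noteq> 0 \<longrightarrow> m \<le> a + b + c}"
  proof clarify
    fix a b c assume "mcoeff (s * p) a b c \<noteq> 0"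
    then show "m \<le> a + b + c"
    proof (rule mcoeff_mult_nonzeroE)
      fix i j k i' j' k' assume "mcoeff p i' j' k' \<noteq> 0" and deg: "a + b + c = i + j + k + (i' + j' + k')"
      then have "m \<le> i' + j' + k'" using p by blast
      with deg show "m \<le> a + b + c" by linarith
    qed
  qed
qed simp

text \<open>Elements of the ideal need not be homogeneous, but none has a monomial of degree below
  \<open>m\<close>, since the generators have none.\<close>

lemma total_degree_ge_if_in_span:
  assumes "p \<in> module.span (*) G" "p \<noteq> 0"
    and "\<And>g. g \<in> G \<Longrightarrow> g \<noteq> 0 \<Longrightarrow> \<exists>n\<ge>m. homogeneous n g"
  shows "m \<le> total_degree p"
proof -
  have "G \<subseteq> {p. \<forall>a b c. mcoeff p a b c \<noteq> 0 \<longrightarrow> m \<le> a + b + c}"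
  proof clarify
    fix g a b c assume "g \<in> G" "mcoeff g a b c \<noteq> 0"
    moreover from this obtain n where "m \<le> n" "homogeneous n g"
      using assms(3)[of g] by (cases "g = 0") auto
    ultimately show "m \<le> a + b + c" by (auto simp: homogeneous_def)
  qed
  from module.span_minimal[OF module_mult this low_order_subspace] assms(1)
  have "\<forall>a b c. mcoeff p a b c \<noteq> 0 \<longrightarrow> m \<le> a + b + c" by auto
  with total_degree_attained[OF assms(2)] show ?thesis by metis
qed

section \<open>Squarefree polynomials and their partial derivatives\<close>

lemma dvd_mult_gcd:
  fixes a c :: "'a::semiring_gcd"
  shows "a dvd c * x \<Longrightarrow> a dvd c * y \<Longrightarrow> a dvd c * gcd x y"
  by (metis dvd_normalize_iff gcd_greatest gcd_mult_left)

text \<open>Let a prime \<open>p\<close> divide \<open>f = p * h\<close> and its partials.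
  Squarefreeness gives \<open>\<not> p dvd h\<close>, so by the product rule \<open>p\<close>
  divides its own partials. These then vanish and \<open>p\<close> is constant.\<close>

lemma squarefree_gcd_partials:
  fixes f :: cpoly3
  assumes "squarefree f"
  shows "is_unit (gcd f (gcd (partial_x f) (gcd (partial_y f) (partial_z f))))" (is "is_unit ?g")
proof (rule ccontr)
  assume not_unit: "\<not> is_unit ?g"
  have "f \<noteq> 0" using assms by auto
  then have "?g \<noteq> 0" by simp
  then obtain p where p: "p dvd ?g" "prime p"
    using prime_divisor_exists not_unit by blast
  then have dvd: "p dvd f" "p dvd partial_x f" "p dvd partial_y f" "p dvd partial_z f" by auto
  then obtain h where f: "f = p * h" by blast
  have "\<not> p dvd h"
  proof
    assume "p dvd h"
    then have "p\<^sup>2 dvd f" by (simp add: f power2_eq_square)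
    then have "is_unit p" using assms by (auto dest: squarefreeD)
    then show False using p(2) not_prime_unit by blast
  qed
  \<comment> \<open>The dividend has the shape that the product rule gives for
    \<open>p * h\<close>.\<close>
  then have *: "p dvd q" if "p dvd q * h + p * r" for q r
  proof -
    have "p dvd q * h" using that by (simp add: dvd_add_left_iff)
    with \<open>\<not> p dvd h\<close> show ?thesis using p(2) prime_dvd_mult_iff by blast
  qed
  have "p dvd partial_x p" "p dvd partial_y p" "p dvd partial_z p"
    using dvd(2-4) unfolding f partial_mult by (auto intro: *)
  then have "homogeneous 0 p"
    by (intro partial_eq_0_imp_homogeneous dvd_partial_imp_0)
  moreover have "p \<noteq> 0" using p(2) by auto
  ultimately have "is_unit p" by (rule homogeneous_0_is_unit)
  then show False using p(2) not_prime_unit by blast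
qed

section \<open>Determinants of derivations\<close>

lemma det_der_matrix: "det (der_matrix a b c) =
    a$1 * b$2 * c$3 + a$2 * b$3 * c$1 + a$3 * b$1 * c$2
    - a$1 * b$3 * c$2 - a$2 * b$1 * c$3 - a$3 * b$2 * c$1"
  by (simp add: der_matrix_def det_3)

lemma det_der_matrix_scale: "det (der_matrix (s *s a) b c) = s * det (der_matrix a b c)"
  unfolding det_der_matrix vector_smult_component by algebra

text \<open>The matrix sends the gradient of \<open>p\<close> to the values of the three
  derivations; the brackets are the cofactors of its columns.\<close>

lemma det_der_matrix_mult_partial:
  "det (der_matrix a b c) * partial_x p = der_apply a p * (b$2 * c$3 - b$3 * c$2) +
    der_apply b p * (c$2 * a$3 - c$3 * a$2) + der_apply c p * (a$2 * b$3 - a$3 * b$2)"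
  "det (der_matrix a b c) * partial_y p = der_apply a p * (b$3 * c$1 - b$1 * c$3) +
    der_apply b p * (c$3 * a$1 - c$1 * a$3) + der_apply c p * (a$3 * b$1 - a$1 * b$3)"
  "det (der_matrix a b c) * partial_z p = der_apply a p * (b$1 * c$2 - b$2 * c$1) +
    der_apply b p * (c$1 * a$2 - c$2 * a$1) + der_apply c p * (a$1 * b$2 - a$2 * b$1)"
  unfolding det_der_matrix der_apply_def by algebra+

text \<open>\<open>f\<close> divides the determinant times \<open>f\<close> and times each partial
  of \<open>f\<close>, hence times their gcd, which is a unit.\<close>

lemma dvd_det_der_matrix:
  assumes "squarefree f" "a \<in> curve_ders f" "b \<in> curve_ders f" "c \<in> curve_ders f"
  shows "f dvd det (der_matrix a b c)"
proof -
  have "f dvd det (der_matrix a b c) * gcd f (gcd (partial_x f) (gcd (partial_y f) (partial_z f)))"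
    using assms(2-4) unfolding curve_ders_def
    by (intro dvd_mult_gcd) (auto simp: det_der_matrix_mult_partial)
  then show ?thesis
    using squarefree_gcd_partials[OF assms(1)] by (simp add: dvd_mult_unit_iff)
qed

lemma homogeneous_det_der_matrix:
  assumes "homogeneous_der d a" "homogeneous_der e b" "homogeneous_der n c"
  shows "homogeneous (d + e + n) (det (der_matrix a b c))"
  using assms unfolding det_der_matrix homogeneous_der_def
  by (intro homogeneous_add homogeneous_diff homogeneous_mult) auto

lemma homogeneous_der_apply:
  assumes "homogeneous_der e \<theta>" "homogeneous (Suc d) p"
  shows "homogeneous (e + d) (der_apply \<theta> p)"
  using assms unfolding der_apply_def homogeneous_der_def
  by (intro homogeneous_add homogeneous_mult homogeneous_partial) auto

lemma homogeneous_der_scale: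
  "homogeneous d p \<Longrightarrow> homogeneous_der e \<theta> \<Longrightarrow> homogeneous_der (d + e) (p *s \<theta>)"
  by (simp add: homogeneous_der_def homogeneous_mult)

lemma homogeneous_der_diff:
  "homogeneous_der e \<theta> \<Longrightarrow> homogeneous_der e \<eta> \<Longrightarrow> homogeneous_der e (\<theta> - \<eta>)"
  by (simp add: homogeneous_der_def homogeneous_diff)

lemma der_apply_scale: "der_apply (s *s \<theta>) p = s * der_apply \<theta> p"
  unfolding der_apply_def vector_smult_component by algebra

lemma der_apply_diff: "der_apply (\<theta> - \<eta>) p = der_apply \<theta> p - der_apply \<eta> p"
  unfolding der_apply_def vector_minus_component by algebra

lemma homogeneous_varX: "homogeneous 1 varX"
  and homogeneous_varY: "homogeneous 1 varY"
  and homogeneous_varZ: "homogeneous 1 varZ"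
  by (auto simp: homogeneous_def mcoeff_def varX_def varY_def varZ_def coeff_pCons split: nat.splits)

lemma varX_nonzero: "varX \<noteq> 0"
  by (simp add: varX_def)

lemma homogeneous_euler_der: "homogeneous_der 1 euler_der"
  by (simp add: homogeneous_der_def euler_der_def forall_3
      homogeneous_varX homogeneous_varY homogeneous_varZ del: One_nat_def)

lemma euler_der_degree: "homogeneous_der e euler_der \<Longrightarrow> e = 1"
  using homogeneous_unique[OF _ homogeneous_varX varX_nonzero]
  by (auto simp: homogeneous_der_def euler_der_def forall_3)

section \<open>Spans, degrees and proportionality of derivations\<close>

lemma span_pairE:
  assumes "x \<in> vec3.span {u, v}"
  obtains s t where "x = s *s u + t *s v"
  using assms by (auto simp: vec3.span_insert vec3.span_singleton algebra_simps)

lemma det_der_matrix_span_singleton: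
  assumes "a \<in> vec3.span {u}" "b \<in> vec3.span {u}"
  shows "det (der_matrix a b c) = 0"
proof -
  obtain s t where ab: "a = s *s u" "b = t *s u"
    using assms by (auto simp: vec3.span_singleton)
  show ?thesis unfolding ab det_der_matrix vector_smult_component by algebra
qed

lemma det_der_matrix_span_pair:
  assumes "a \<in> vec3.span {u, v}" "b \<in> vec3.span {u, v}" "c \<in> vec3.span {u, v}"
  shows "det (der_matrix a b c) = 0"
proof -
  obtain s t s' t' s'' t'' where abc: "a = s *s u + t *s v" "b = s' *s u + t' *s v" "c = s'' *s u + t'' *s v"
    using assms by (metis span_pairE)
  show ?thesis unfolding abc det_der_matrix vector_smult_component vector_add_component
    by algebra
qed

text \<open>Take the degree \<open>e\<close> part of a linear combination: coefficients become forms
  of degree \<open>e - \<delta> v\<close>, and generators of degree above \<open>e\<close> drop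
  out.\<close>

lemma homogeneous_in_span_lower_degree:
  fixes \<theta> :: der3
  assumes "finite T" "\<And>v. v \<in> T \<Longrightarrow> homogeneous_der (\<delta> v) v"
    and "\<theta> \<in> vec3.span T" "homogeneous_der e \<theta>"
  shows "\<theta> \<in> vec3.span {v \<in> T. \<delta> v \<le> e}"
proof -
  obtain c where c: "\<theta> = (\<Sum>v\<in>T. c v *s v)"
    using assms(3) unfolding vec3.span_finite[OF assms(1)] by auto
  have "\<theta> $ i = (\<Sum>v\<in>{v \<in> T. \<delta> v \<le> e}. hom_comp (e - \<delta> v) (c v) *s v) $ i" for i
  proof -
    have "\<theta> $ i = hom_comp e (\<theta> $ i)"
      using assms(4) by (simp add: homogeneous_der_def hom_comp_homogeneous)
    also have "\<dots> = (\<Sum>v\<in>T. hom_comp e (c v * v $ i))"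
      by (simp add: c hom_comp_sum)
    also have "\<dots> = (\<Sum>v\<in>T. if \<delta> v \<le> e then hom_comp (e - \<delta> v) (c v) * v $ i else 0)"
      using assms(2) by (intro sum.cong refl hom_comp_mult_homogeneous) (simp add: homogeneous_der_def)
    also have "\<dots> = (\<Sum>v\<in>{v \<in> T. \<delta> v \<le> e}. hom_comp (e - \<delta> v) (c v) * v $ i)"
      by (simp add: sum.inter_filter[OF assms(1)])
    also have "\<dots> = (\<Sum>v\<in>{v \<in> T. \<delta> v \<le> e}. hom_comp (e - \<delta> v) (c v) *s v) $ i"
      by simp
    finally show ?thesis .
  qed
  then have "\<theta> = (\<Sum>v\<in>{v \<in> T. \<delta> v \<le> e}. hom_comp (e - \<delta> v) (c v) *s v)"
    by (simp add: vec_eq_iff)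
  also have "\<dots> \<in> vec3.span {v \<in> T. \<delta> v \<le> e}"
    by (intro vec3.span_sum vec3.span_scale vec3.span_base)
  finally show ?thesis .
qed

text \<open>Uses unique factorization: \<open>\<eta>\<close> is \<open>u\<close> divided by the gcd
  \<open>c\<close> of its entries, and the primitive vector \<open>\<eta>\<close> then divides
  \<open>v\<close>.\<close>

lemma parallel_common_factor:
  fixes u v :: der3
  assumes "u \<noteq> 0" "\<And>i j. u $ i * v $ j = u $ j * v $ i"
  obtains c q \<eta> where "u = c *s \<eta>" "v = q *s \<eta>"
proof -
  define c where "c = gcd (u $ 1) (gcd (u $ 2) (u $ 3))"
  have "c dvd u $ i" for i
    using exhaust_3[of i] by (auto simp: c_def intro: dvd_trans)
  then have "\<exists>h. u $ i = c * h" for i by blast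
  then obtain h where h: "\<And>i. u $ i = c * h i" by metis
  have c0: "c \<noteq> 0" using assms(1) by (auto simp: h vec_eq_iff)
  obtain i where i: "u $ i \<noteq> 0" using assms(1) by (auto simp: vec_eq_iff)
  \<comment> \<open>Divisibility for all \<open>j\<close> passes to the gcd \<open>c\<close> of the
    entries of \<open>u\<close>; cancelling \<open>c\<close> leaves
    \<open>h i dvd v $ i\<close>.\<close>
  have "u $ i dvd v $ i * u $ j" for j
    using assms(2)[of i j] by (metis dvd_triv_left mult.commute)
  then have "u $ i dvd v $ i * c"
    unfolding c_def by (intro dvd_mult_gcd)
  then have "h i dvd v $ i" using c0 by (simp add: h mult.commute)
  then obtain q where q: "v $ i = h i * q" by blast
  have "v $ j = q * h j" for j
  proof -
    have "u $ i * v $ j = u $ i * (q * h j)"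
      using assms(2)[of i j] by (simp add: q h mult.commute[of q])
    with i show ?thesis by simp
  qed
  then show thesis
    by (intro that[of c "\<chi> i. h i" q]) (simp_all add: vec_eq_iff h)
qed

text \<open>The common factor \<open>\<eta>\<close> is not known to be homogeneous. Its lowest
  component \<open>\<eta>'\<close> replaces it: a homogeneous multiple of \<open>\<eta>\<close>
  equals its own lowest component, the product of the lowest components of \<open>c\<close> and
  \<open>\<eta>\<close>.\<close>

lemma lowest_form:
  fixes \<eta> :: der3
  assumes "\<eta> \<noteq> 0"
  obtains m \<eta>' where "homogeneous_der m \<eta>'"
    "\<And>c e. c *s \<eta> \<noteq> 0 \<Longrightarrow> homogeneous_der e (c *s \<eta>) \<Longrightarrow>
      \<exists>j c'. e = j + m \<and> homogeneous j c' \<and> c *s \<eta> = c' *s \<eta>'"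
proof -
  \<comment> \<open>One order \<open>m\<close> serves all three entries, so some, but not all,
    entries of \<open>\<eta>'\<close> may vanish.\<close>
  define m where "m = (LEAST m. \<exists>i. hom_comp m (\<eta> $ i) \<noteq> 0)"
  define \<eta>' :: der3 where "\<eta>' = (\<chi> i. hom_comp m (\<eta> $ i))"
  have "\<exists>m i. hom_comp m (\<eta> $ i) \<noteq> 0"
    using assms hom_comp_nonzero_ex by (metis vec_eq_iff zero_index)
  then have "\<exists>i. hom_comp m (\<eta> $ i) \<noteq> 0" unfolding m_def by (rule LeastI_ex)
  then obtain i0 where i0: "hom_comp m (\<eta> $ i0) \<noteq> 0" ..
  have low: "hom_comp n (\<eta> $ i) = 0" if "n < m" for n i
    using not_less_Least[OF that[unfolded m_def]] by blast
  show thesis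
  proof (rule that)
    show "homogeneous_der m \<eta>'"
      by (simp add: homogeneous_der_def \<eta>'_def homogeneous_hom_comp)
    fix c e assume nz: "c *s \<eta> \<noteq> 0" and hom: "homogeneous_der e (c *s \<eta>)"
    define j where "j = (LEAST j. hom_comp j c \<noteq> 0)"
    have "c \<noteq> 0" using nz by auto
    then have j: "hom_comp j c \<noteq> 0"
      unfolding j_def by (rule LeastI_ex[OF hom_comp_nonzero_ex])
    have c_low: "hom_comp n c = 0" if "n < j" for n
      using not_less_Least[OF that[unfolded j_def]] by blast
    have prod: "hom_comp (j + m) ((c *s \<eta>) $ i) = (hom_comp j c *s \<eta>') $ i" for i
      unfolding \<eta>'_def vector_smult_component vec_lambda_beta
      using c_low low by (rule hom_comp_mult_lowest)
    have hom_i: "homogeneous e ((c *s \<eta>) $ i)" for i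
      using hom by (simp only: homogeneous_der_def)
    \<comment> \<open>The nonzero component at entry \<open>i0\<close> fixes the degree
      \<open>e\<close>.\<close>
    have "hom_comp (j + m) ((c *s \<eta>) $ i0) \<noteq> 0"
      unfolding prod using i0 j by (simp add: \<eta>'_def)
    then have e: "e = j + m" using hom_comp_homogeneous_other[OF hom_i[of i0], of "j + m"] by blast
    have "c *s \<eta> = hom_comp j c *s \<eta>'"
      unfolding vec_eq_iff prod[symmetric] using hom_comp_homogeneous[OF hom_i] e by simp
    with e show "\<exists>j c'. e = j + m \<and> homogeneous j c' \<and> c *s \<eta> = c' *s \<eta>'"
      using homogeneous_hom_comp by blast
  qed
qed

section \<open>Minimal generators\<close>

text \<open>Fixes a system of generators whose existence \<open>generalized_exponents\<close>
  asserts, together with the degree \<open>d\<close> of \<open>f\<close>.\<close>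

locale minimal_generators =
  fixes f :: cpoly3 and d :: nat and ds :: "nat list" and \<theta>s :: "der3 list"
  assumes homogeneous_f: "homogeneous d f" and d_pos: "d > 0" and squarefree_f: "squarefree f"
    and nonempty: "\<theta>s \<noteq> []" and euler: "\<theta>s ! 0 = euler_der" and distinct: "distinct \<theta>s"
    and degrees: "list_all2 homogeneous_der ds \<theta>s" and sorted: "sorted ds"
    and span_eq: "vec3.span (set \<theta>s) = curve_ders f"
    and irredundant: "\<And>T. T \<subset> set \<theta>s \<Longrightarrow> vec3.span T \<noteq> curve_ders f"
begin

lemma f_nonzero: "f \<noteq> 0"
  using squarefree_f by auto

lemma length_ds: "length ds = length \<theta>s"
  using degrees by (rule list_all2_lengthD)

lemma homogeneous_nth: "i < length \<theta>s \<Longrightarrow> homogeneous_der (ds ! i) (\<theta>s ! i)"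
  using degrees list_all2_nthD2 by blast

lemma nth_in_curve_ders: "i < length \<theta>s \<Longrightarrow> \<theta>s ! i \<in> curve_ders f"
  using span_eq vec3.span_base nth_mem by metis

text \<open>Otherwise the remaining generators would still span, against irredundancy; distinctness
  keeps the generator itself out of the earlier ones.\<close>

lemma nth_notin_span_take:
  assumes "i < length \<theta>s"
  shows "\<theta>s ! i \<notin> vec3.span (set (take i \<theta>s))"
proof
  assume *: "\<theta>s ! i \<in> vec3.span (set (take i \<theta>s))"
  have "\<theta>s ! i \<notin> set (take i \<theta>s)"
    using distinct assms by (auto simp: in_set_conv_nth nth_eq_iff_index_eq)
  then have "set (take i \<theta>s) \<subseteq> set \<theta>s - {\<theta>s ! i}"
    using set_take_subset[of i \<theta>s] by auto
  then have "\<theta>s ! i \<in> vec3.span (set \<theta>s - {\<theta>s ! i})"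
    using * vec3.span_mono by blast
  then have "set \<theta>s \<subseteq> vec3.span (set \<theta>s - {\<theta>s ! i})"
    using vec3.span_superset[of "set \<theta>s - {\<theta>s ! i}"] by auto
  then have "vec3.span (set \<theta>s) \<subseteq> vec3.span (set \<theta>s - {\<theta>s ! i})"
    by (rule vec3.span_minimal[OF _ vec3.subspace_span])
  moreover have "vec3.span (set \<theta>s - {\<theta>s ! i}) \<subseteq> vec3.span (set \<theta>s)"
    by (rule vec3.span_mono) blast
  moreover have "set \<theta>s - {\<theta>s ! i} \<subset> set \<theta>s"
    using assms nth_mem by blast
  ultimately show False
    using irredundant span_eq by blast
qed

text \<open>By sortedness, generators of degree at most \<open>e\<close> all come before position
  \<open>i\<close>. For \<open>i\<close> beyond the list the degree condition is vacuous and the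
  span is everything.\<close>

lemma low_degree_in_span_take:
  assumes "\<theta> \<in> curve_ders f" "homogeneous_der e \<theta>" "i < length \<theta>s \<Longrightarrow> e < ds ! i"
  shows "\<theta> \<in> vec3.span (set (take i \<theta>s))"
proof -
  \<comment> \<open>The degree of a generator is read off at its position, unique because the list
    is distinct.\<close>
  define \<delta> where "\<delta> v = ds ! (THE j. j < length \<theta>s \<and> \<theta>s ! j = v)" for v
  have \<delta>: "\<delta> (\<theta>s ! j) = ds ! j" if "j < length \<theta>s" for j
  proof -
    have "(THE k. k < length \<theta>s \<and> \<theta>s ! k = \<theta>s ! j) = j"
      using that distinct by (intro the_equality) (auto simp: nth_eq_iff_index_eq)
    then show ?thesis by (simp add: \<delta>_def)
  qed
  have "\<theta> \<in> vec3.span {v \<in> set \<theta>s. \<delta> v \<le> e}"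
    using assms(1,2) span_eq
    by (intro homogeneous_in_span_lower_degree) (auto simp: in_set_conv_nth \<delta> homogeneous_nth)
  moreover have "{v \<in> set \<theta>s. \<delta> v \<le> e} \<subseteq> set (take i \<theta>s)"
  proof clarify
    fix v assume "v \<in> set \<theta>s" and le: "\<delta> v \<le> e"
    then obtain j where j: "j < length \<theta>s" "v = \<theta>s ! j" by (metis in_set_conv_nth)
    have "j < i"
    proof (rule ccontr)
      assume "\<not> j < i"
      then have "ds ! i \<le> ds ! j" using sorted_nth_mono[OF sorted] j length_ds by simp
      then show False using assms(3) j le \<delta>[of j] \<open>\<not> j < i\<close> by simp
    qed
    with j show "v \<in> set (take i \<theta>s)" by (auto simp: in_set_conv_nth)
  qed
  ultimately show ?thesis using vec3.span_mono by blast
qed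

lemma take_1: "set (take (Suc 0) \<theta>s) = {euler_der}"
  using nonempty euler by (cases \<theta>s) auto

text \<open>The multiples of the coordinate derivations by \<open>f\<close> lie in
  \<open>curve_ders f\<close> and have determinant \<open>f^3\<close>, impossible with two
  generators.\<close>

lemma length_ge_3: "3 \<le> length \<theta>s"
proof (rule ccontr)
  assume "\<not> 3 \<le> length \<theta>s"
  then have "\<exists>u v. set \<theta>s \<subseteq> {u, v}"
    using nonempty by (cases \<theta>s; cases "tl \<theta>s"; cases "tl (tl \<theta>s)") auto
  then obtain u v where "set \<theta>s \<subseteq> {u, v}" by blast
  then have *: "\<theta> \<in> vec3.span {u, v}" if "\<theta> \<in> curve_ders f" for \<theta>
    using that span_eq vec3.span_mono by blast
  define a b c :: der3 where "a = vector [f, 0, 0]" and "b = vector [0, f, 0]" and "c = vector [0, 0, f]"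
  have "a \<in> curve_ders f" "b \<in> curve_ders f" "c \<in> curve_ders f"
    by (auto simp: curve_ders_def der_apply_def a_def b_def c_def)
  then have "det (der_matrix a b c) = 0"
    by (metis * det_der_matrix_span_pair)
  then show False
    using f_nonzero by (simp add: det_der_matrix a_def b_def c_def)
qed

lemma ds_0: "ds ! 0 = 1"
  using homogeneous_nth[of 0] nonempty euler euler_der_degree by simp

lemma ds_ge_1: "i < length \<theta>s \<Longrightarrow> 1 \<le> ds ! i"
  using sorted_nth_mono[OF sorted, of 0 i] length_ds ds_0 by simp

lemma take_2: "set (take 2 \<theta>s) = {euler_der, \<theta>s ! 1}"
proof -
  obtain u v w where "\<theta>s = u # v # w"
    using length_ge_3 by (cases \<theta>s; cases "tl \<theta>s") auto
  then show ?thesis using euler by (simp add: numeral_2_eq_2)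
qed

text \<open>Three bounds by rank: \<open>x < 1\<close> forces \<open>a = 0\<close>,
  \<open>y < ds ! 1\<close> makes \<open>a\<close> and \<open>b\<close> multiples of the Euler
  derivation, and \<open>z < ds ! 2\<close> puts all three in the span of two generators.\<close>

lemma sorted_degree_sum_ge:
  assumes "a \<in> curve_ders f" "b \<in> curve_ders f" "c \<in> curve_ders f"
    and "homogeneous_der x a" "homogeneous_der y b" "homogeneous_der z c"
    and "x \<le> y" "y \<le> z" and "det (der_matrix a b c) \<noteq> 0"
  shows "1 + ds ! 1 + ds ! 2 \<le> x + y + z"
proof -
  note in_span = low_degree_in_span_take[OF assms(1,4)] low_degree_in_span_take[OF assms(2,5)]
    low_degree_in_span_take[OF assms(3,6)]
  have "1 \<le> x"
  proof (rule ccontr)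
    assume "\<not> 1 \<le> x"
    then have "a = 0" using in_span(1)[of 0] ds_0 by simp
    then show False using assms(9) by (simp add: det_der_matrix)
  qed
  moreover have "ds ! 1 \<le> y"
  proof (rule ccontr)
    assume "\<not> ds ! 1 \<le> y"
    then have "a \<in> vec3.span {euler_der}" "b \<in> vec3.span {euler_der}"
      using in_span(1,2)[of "Suc 0"] assms(7) take_1 by auto
    then show False using assms(9) det_der_matrix_span_singleton by blast
  qed
  moreover have "ds ! 2 \<le> z"
  proof (rule ccontr)
    assume "\<not> ds ! 2 \<le> z"
    then have "a \<in> vec3.span {euler_der, \<theta>s ! 1}" "b \<in> vec3.span {euler_der, \<theta>s ! 1}"
      "c \<in> vec3.span {euler_der, \<theta>s ! 1}"
      using in_span[of 2] assms(7,8) take_2 by auto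
    then show False using assms(9) det_der_matrix_span_pair by blast
  qed
  ultimately show ?thesis by linarith
qed

text \<open>Sorting the three derivations by degree changes the determinant at most by a
  sign.\<close>

lemma degree_sum_ge:
  assumes abc: "a \<in> curve_ders f" "b \<in> curve_ders f" "c \<in> curve_ders f"
    and hom: "homogeneous_der x a" "homogeneous_der y b" "homogeneous_der z c"
    and det: "det (der_matrix a b c) \<noteq> 0"
  shows "1 + ds ! 1 + ds ! 2 \<le> x + y + z"
proof -
  have perm: "det (der_matrix a c b) = - det (der_matrix a b c)"
    "det (der_matrix b a c) = - det (der_matrix a b c)"
    "det (der_matrix c b a) = - det (der_matrix a b c)"
    "det (der_matrix b c a) = det (der_matrix a b c)"
    "det (der_matrix c a b) = det (der_matrix a b c)"
    unfolding det_der_matrix by algebra+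
  consider "x \<le> y" "y \<le> z" | "x \<le> z" "z \<le> y" | "y \<le> x" "x \<le> z"
    | "y \<le> z" "z \<le> x" | "z \<le> x" "x \<le> y" | "z \<le> y" "y \<le> x" by linarith
  then show ?thesis
  proof cases
    case 1 then show ?thesis using sorted_degree_sum_ge[OF abc(1,2,3) hom(1,2,3)] det by simp
  next
    case 2 then show ?thesis using sorted_degree_sum_ge[OF abc(1,3,2) hom(1,3,2)] det perm by simp
  next
    case 3 then show ?thesis using sorted_degree_sum_ge[OF abc(2,1,3) hom(2,1,3)] det perm by simp
  next
    case 4 then show ?thesis using sorted_degree_sum_ge[OF abc(2,3,1) hom(2,3,1)] det perm by simp
  next
    case 5 then show ?thesis using sorted_degree_sum_ge[OF abc(3,1,2) hom(3,1,2)] det perm by simp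
  next
    case 6 then show ?thesis using sorted_degree_sum_ge[OF abc(3,2,1) hom(3,2,1)] det perm by simp
  qed
qed

section \<open>Independence of the first three generators\<close>

lemma of_nat_d_nonzero: "of_nat d \<noteq> (0 :: cpoly3)"
  using d_pos by (simp add: of_nat_const3 const3_def)

lemma der_apply_euler: "der_apply euler_der f = of_nat d * f"
  using homogeneous_f by (rule euler_formula)

text \<open>Euler's formula shows that \<open>\<theta>(f) / (d f)\<close> is the multiple of the Euler derivation to
  subtract.\<close>

lemma euler_complement:
  assumes "\<theta> \<in> curve_ders f" "homogeneous_der e \<theta>" "1 \<le> e"
  obtains \<alpha> where "homogeneous_der e (\<theta> - \<alpha> *s euler_der)" "der_apply (\<theta> - \<alpha> *s euler_der) f = 0"
proof -
  obtain h where h: "der_apply \<theta> f = h * f"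
    using assms(1) unfolding curve_ders_def by (metis dvdE mem_Collect_eq mult.commute)
  \<comment> \<open>\<open>\<theta>(f)\<close> has degree \<open>e + (d - 1)\<close>, so
    \<open>h\<close> has degree \<open>e - 1\<close> and its product with the Euler derivation has
    degree \<open>e\<close>.\<close>
  obtain d' where d': "d = Suc d'" using d_pos by (cases d) auto
  obtain m where m: "e = Suc m" using assms(3) by (cases e) auto
  have "homogeneous (e + d') (h * f)"
    using homogeneous_der_apply[OF assms(2)] homogeneous_f unfolding d' h[symmetric] by blast
  then have "homogeneous m h"
    using homogeneous_factor[OF _ homogeneous_f f_nonzero, of "e + d'" h] d' m
    by (cases "h = 0") auto
  define \<alpha> where "\<alpha> = const3 (1 / of_nat d) * h"
  have "homogeneous m \<alpha>"
    using homogeneous_mult[OF homogeneous_const3 \<open>homogeneous m h\<close>] by (simp add: \<alpha>_def)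
  then have "homogeneous_der e (\<theta> - \<alpha> *s euler_der)"
    using homogeneous_der_scale[OF _ homogeneous_euler_der, of m \<alpha>] assms(2) m
    by (intro homogeneous_der_diff) auto
  moreover have "of_nat d * const3 (1 / of_nat d) = 1"
    using d_pos by (simp add: of_nat_const3 const3_mult const3_1)
  then have eq: "\<alpha> * (of_nat d * f) = h * f"
    unfolding \<alpha>_def by algebra
  then have "der_apply (\<theta> - \<alpha> *s euler_der) f = 0"
    unfolding der_apply_diff der_apply_scale der_apply_euler h eq by simp
  ultimately show thesis by (rule that)
qed

text \<open>If the determinant vanished, the components of the second and third generator killing \<open>f\<close>
  would be proportional, hence multiples of a homogeneous derivation killing \<open>f\<close>; that one either
  has smaller degree than the second generator or makes the third one redundant.\<close>

lemma det_first_generators_nonzero: "det (der_matrix euler_der (\<theta>s ! 1) (\<theta>s ! 2)) \<noteq> 0"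
proof
  assume det0: "det (der_matrix euler_der (\<theta>s ! 1) (\<theta>s ! 2)) = 0"
  have len: "1 < length \<theta>s" "2 < length \<theta>s" using length_ge_3 by auto
  obtain \<alpha> where \<alpha>: "homogeneous_der (ds ! 1) (\<theta>s ! 1 - \<alpha> *s euler_der)"
    "der_apply (\<theta>s ! 1 - \<alpha> *s euler_der) f = 0"
    using euler_complement[OF nth_in_curve_ders homogeneous_nth ds_ge_1] len(1) by metis
  obtain \<beta> where \<beta>: "homogeneous_der (ds ! 2) (\<theta>s ! 2 - \<beta> *s euler_der)"
    "der_apply (\<theta>s ! 2 - \<beta> *s euler_der) f = 0"
    using euler_complement[OF nth_in_curve_ders homogeneous_nth ds_ge_1] len(2) by metis
  define u where "u = \<theta>s ! 1 - \<alpha> *s euler_der"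
  define v where "v = \<theta>s ! 2 - \<beta> *s euler_der"
  have \<theta>1: "\<theta>s ! 1 = u + \<alpha> *s euler_der" and \<theta>2: "\<theta>s ! 2 = v + \<beta> *s euler_der"
    by (simp_all add: u_def v_def)
  have \<theta>1_notin: "\<theta>s ! 1 \<notin> vec3.span {euler_der}"
    using nth_notin_span_take[OF len(1)] take_1 by simp
  have \<theta>2_notin: "\<theta>s ! 2 \<notin> vec3.span {euler_der, \<theta>s ! 1}"
    using nth_notin_span_take[OF len(2)] take_2 by simp
  have u0: "u \<noteq> 0"
    using \<theta>1_notin unfolding \<theta>1
    by (auto intro: vec3.span_scale[OF vec3.span_base])
  have v0: "v \<noteq> 0"
    using \<theta>2_notin unfolding \<theta>2
    by (auto intro: vec3.span_scale[OF vec3.span_base])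
  \<comment> \<open>Subtracting multiples of the Euler row leaves the determinant unchanged.\<close>
  have det_uv: "det (der_matrix euler_der u v) = 0"
    using det0 unfolding \<theta>1 \<theta>2 det_der_matrix vector_add_component vector_smult_component
    by algebra
  have u_f: "der_apply u f = 0" and v_f: "der_apply v f = 0"
    using \<alpha>(2) \<beta>(2) by (simp_all add: u_def v_def)
  have "of_nat d * f \<noteq> 0" using of_nat_d_nonzero f_nonzero by simp
  \<comment> \<open>In Cramer's identities only the term with \<open>der_apply euler_der f\<close>
    survives, so its cofactors, the minors of \<open>u\<close> and \<open>v\<close>, vanish.\<close>
  then have "u$2 * v$3 = u$3 * v$2" "u$3 * v$1 = u$1 * v$3" "u$1 * v$2 = u$2 * v$1"
    using det_der_matrix_mult_partial[of euler_der u v f] unfolding det_uv u_f v_f der_apply_euler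
    by auto
  then have "u $ i * v $ j = u $ j * v $ i" for i j
    using exhaust_3[of i] exhaust_3[of j] by auto
  then obtain c q \<eta> where \<eta>: "u = c *s \<eta>" "v = q *s \<eta>"
    using parallel_common_factor[OF u0] by metis
  then have "\<eta> \<noteq> 0" using u0 by auto
  then obtain m \<eta>' where hom_\<eta>': "homogeneous_der m \<eta>'"
    and lowest: "\<And>c e. c *s \<eta> \<noteq> 0 \<Longrightarrow> homogeneous_der e (c *s \<eta>) \<Longrightarrow>
      \<exists>j c'. e = j + m \<and> homogeneous j c' \<and> c *s \<eta> = c' *s \<eta>'"
    using lowest_form by metis
  obtain j c' where c': "ds ! 1 = j + m" "homogeneous j c'" "u = c' *s \<eta>'"
    using lowest[of c "ds ! 1"] u0 \<alpha>(1) \<eta>(1) u_def by metis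
  obtain q' where q': "v = q' *s \<eta>'"
    using lowest[of q "ds ! 2"] v0 \<beta>(1) \<eta>(2) v_def by metis
  have "c' \<noteq> 0" using c'(3) u0 by auto
  then have \<eta>'_f: "der_apply \<eta>' f = 0"
    using u_f by (simp add: c'(3) der_apply_scale)
  show False
  proof (cases "j = 0")
    \<comment> \<open>\<open>c'\<close> is a nonzero constant, so \<open>v\<close> is a multiple of
      \<open>u\<close> and \<open>\<theta>s ! 2\<close> lies in the span of the first two
      generators.\<close>
    case True
    then have "is_unit c'" using c'(2) \<open>c' \<noteq> 0\<close> homogeneous_0_is_unit by simp
    then obtain r where r: "1 = c' * r" by (elim dvdE)
    have "q' = q' * r * c'" using r by algebra
    then have "v = (q' * r) *s u"
      unfolding q' c'(3) vector_smult_assoc by (rule arg_cong)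
    also have "\<dots> = (q' * r) *s \<theta>s ! 1 - (q' * r * \<alpha>) *s euler_der"
      by (simp add: u_def vec3.scale_right_diff_distrib)
    finally have "\<theta>s ! 2 = (q' * r) *s \<theta>s ! 1 - (q' * r * \<alpha>) *s euler_der + \<beta> *s euler_der"
      using \<theta>2 by simp
    also have "\<dots> \<in> vec3.span {euler_der, \<theta>s ! 1}"
      by (intro vec3.span_add vec3.span_diff vec3.span_scale vec3.span_base) auto
    finally show False using \<theta>2_notin by simp
  next
    \<comment> \<open>By its degree \<open>\<eta>'\<close> is a multiple of the Euler derivation;
      since it kills \<open>f\<close>, it is 0, against \<open>u0\<close>.\<close>
    case False
    then have "m < ds ! 1" using c'(1) by simp
    moreover have "\<eta>' \<in> curve_ders f" by (simp add: curve_ders_def \<eta>'_f)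
    ultimately have "\<eta>' \<in> vec3.span {euler_der}"
      using low_degree_in_span_take[OF _ hom_\<eta>', of "Suc 0"] take_1 by simp
    then obtain s where s: "\<eta>' = s *s euler_der" by (auto simp: vec3.span_singleton)
    have "s * (of_nat d * f) = 0"
      using \<eta>'_f by (simp add: s der_apply_scale der_apply_euler)
    then have "s = 0" using \<open>of_nat d * f \<noteq> 0\<close> by (simp del: of_nat_eq_0_iff)
    then show False using u0 by (simp add: c'(3) s)
  qed
qed

end

section \<open>Comparison of the type with the initial degree\<close>

lemma generalized_exponentsE:
  assumes "reduced_plane_curve f" "generalized_exponents f ds"
  obtains \<theta>s where "minimal_generators f (total_degree f) ds \<theta>s"
proof -
  obtain d where d: "d > 0" "homogeneous d f" and sqf: "squarefree f"
    using assms(1) unfolding reduced_plane_curve_def by blast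
  have "f \<noteq> 0" using sqf by auto
  then have "total_degree f = d" using d(2) total_degree_homogeneous by blast
  then show thesis
    using assms(2) d sqf that unfolding generalized_exponents_def minimal_generators_def by blast
qed

lemma homogeneous_power: "homogeneous d p \<Longrightarrow> homogeneous (n * d) (p ^ n)"
  by (induction n) (use homogeneous_const3[of 1] in \<open>auto simp: const3_1 homogeneous_mult\<close>)

theorem proposition3p7:
  fixes f :: cpoly3 and ds :: "nat list" and k :: nat
  assumes "reduced_plane_curve f"
    and "generalized_exponents f ds"
  shows "curve_type f ds \<le> int k \<longleftrightarrow>
    (\<exists>H. H \<subseteq> curve_ders f \<and> (\<forall>\<theta>\<in>H. \<exists>e. homogeneous_der e \<theta>) \<and>
         J_ideal f H \<noteq> {0} \<and> Indeg (J_ideal f H) = k)"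
proof -
  define d where "d = total_degree f"
  obtain \<theta>s where "minimal_generators f d ds \<theta>s"
    using generalized_exponentsE[OF assms] d_def by blast
  then interpret minimal_generators f d ds \<theta>s .
  define G where "G H = {g. \<exists>\<theta>1\<in>H. \<exists>\<theta>2\<in>H. \<exists>\<theta>3\<in>H. det (der_matrix \<theta>1 \<theta>2 \<theta>3) = g * f}" for H
  have J: "J_ideal f H = module.span (*) (G H)" for H
    by (simp add: J_ideal_def G_def)
  show ?thesis
  proof
    assume type: "curve_type f ds \<le> int k"
    have len: "1 < length \<theta>s" "2 < length \<theta>s" using length_ge_3 by auto
    have in_ders: "euler_der \<in> curve_ders f" "\<theta>s ! 1 \<in> curve_ders f" "\<theta>s ! 2 \<in> curve_ders f"
      using nth_in_curve_ders[of 0] nth_in_curve_ders len euler nonempty by auto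
    obtain g where g: "det (der_matrix euler_der (\<theta>s ! 1) (\<theta>s ! 2)) = g * f"
      using dvd_det_der_matrix[OF squarefree_f in_ders] by (metis dvdE mult.commute)
    have g0: "g \<noteq> 0" using det_first_generators_nonzero g by auto
    have "homogeneous (1 + ds ! 1 + ds ! 2) (g * f)"
      unfolding g[symmetric]
      by (intro homogeneous_det_der_matrix homogeneous_euler_der homogeneous_nth len)
    \<comment> \<open>Since \<open>1 + ds ! 1 + ds ! 2 = t + d\<close>, the natural number
      \<open>t\<close> is the type.\<close>
    then obtain t where t: "1 + ds ! 1 + ds ! 2 = t + d" "homogeneous t g"
      using homogeneous_f f_nonzero g0 by (rule homogeneous_factor)
    have "t \<le> k" using type t(1) by (simp add: curve_type_def d_def)
    define \<eta> where "\<eta> = varX ^ (k - t) *s euler_der"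
    have hom_\<eta>: "homogeneous_der (k - t + 1) \<eta>"
      unfolding \<eta>_def using homogeneous_power[OF homogeneous_varX, of "k - t"]
      by (intro homogeneous_der_scale homogeneous_euler_der) simp
    have \<eta>_in: "\<eta> \<in> curve_ders f"
      using in_ders(1) by (simp add: \<eta>_def curve_ders_def der_apply_scale)
    define H where "H = {\<eta>, \<theta>s ! 1, \<theta>s ! 2}"
    have "det (der_matrix \<eta> (\<theta>s ! 1) (\<theta>s ! 2)) = varX ^ (k - t) * g * f"
      unfolding \<eta>_def det_der_matrix_scale g by (rule mult.assoc[symmetric])
    then have gen: "varX ^ (k - t) * g \<in> G H"
      by (auto simp: G_def H_def)
    have nz: "varX ^ (k - t) * g \<noteq> 0" using g0 varX_nonzero by simp
    have "homogeneous (k - t + t) (varX ^ (k - t) * g)"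
      using homogeneous_power[OF homogeneous_varX, of "k - t"] t(2) by (intro homogeneous_mult) simp_all
    then have deg: "total_degree (varX ^ (k - t) * g) = k"
      using nz \<open>t \<le> k\<close> by (simp add: total_degree_homogeneous)
    have hom_G: "\<exists>n\<ge>k. homogeneous n h" if h: "h \<in> G H" "h \<noteq> 0" for h
    proof -
      obtain a b c where abc: "a \<in> H" "b \<in> H" "c \<in> H" and det: "det (der_matrix a b c) = h * f"
        using h(1) by (auto simp: G_def)
      have det0: "det (der_matrix a b c) \<noteq> 0" using det h(2) f_nonzero by simp
      \<comment> \<open>A repeated row would give determinant 0, so the triple is an ordering of
        \<open>H\<close> and its degree sum is always the same.\<close>
      then have "a \<noteq> b" "a \<noteq> c" "b \<noteq> c" by (auto simp: det_der_matrix algebra_simps)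
      have hom: "homogeneous_der (k - t + 1) \<eta>" "homogeneous_der (ds ! 1) (\<theta>s ! 1)"
        "homogeneous_der (ds ! 2) (\<theta>s ! 2)"
        using hom_\<eta> homogeneous_nth len by auto
      have "homogeneous (k - t + 1 + ds ! 1 + ds ! 2) (det (der_matrix a b c))"
        using abc \<open>a \<noteq> b\<close> \<open>a \<noteq> c\<close> \<open>b \<noteq> c\<close> homogeneous_det_der_matrix[OF hom(1,2,3)]
          homogeneous_det_der_matrix[OF hom(1,3,2)] homogeneous_det_der_matrix[OF hom(2,1,3)]
          homogeneous_det_der_matrix[OF hom(2,3,1)] homogeneous_det_der_matrix[OF hom(3,1,2)]
          homogeneous_det_der_matrix[OF hom(3,2,1)]
        unfolding H_def by (auto simp: ac_simps)
      moreover have "k - t + 1 + ds ! 1 + ds ! 2 = k + d" using t(1) \<open>t \<le> k\<close> by linarith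
      ultimately have "homogeneous (k + d) (h * f)" using det by simp
      then obtain m where "k + d = m + d" "homogeneous m h"
        using homogeneous_f f_nonzero h(2) by (rule homogeneous_factor)
      then show ?thesis by auto
    qed
    show "\<exists>H. H \<subseteq> curve_ders f \<and> (\<forall>\<theta>\<in>H. \<exists>e. homogeneous_der e \<theta>) \<and>
         J_ideal f H \<noteq> {0} \<and> Indeg (J_ideal f H) = k"
    proof (rule exI[of _ H], intro conjI ballI)
      show "H \<subseteq> curve_ders f" using \<eta>_in in_ders by (simp add: H_def)
      show "\<exists>e. homogeneous_der e \<theta>" if "\<theta> \<in> H" for \<theta>
        using that hom_\<eta> homogeneous_nth[OF len(1)] homogeneous_nth[OF len(2)]
        unfolding H_def by blast
      have mem: "varX ^ (k - t) * g \<in> J_ideal f H"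
        unfolding J using gen by (rule module.span_base[OF module_mult])
      then show "J_ideal f H \<noteq> {0}" using nz by blast
      show "Indeg (J_ideal f H) = k"
        unfolding Indeg_def
      proof (rule Least_equality)
        show "\<exists>p\<in>J_ideal f H. p \<noteq> 0 \<and> total_degree p = k" using mem nz deg by blast
        show "k \<le> e" if "\<exists>p\<in>J_ideal f H. p \<noteq> 0 \<and> total_degree p = e" for e
          using that hom_G unfolding J by (auto intro: total_degree_ge_if_in_span)
      qed
    qed
  next
    assume "\<exists>H. H \<subseteq> curve_ders f \<and> (\<forall>\<theta>\<in>H. \<exists>e. homogeneous_der e \<theta>) \<and>
         J_ideal f H \<noteq> {0} \<and> Indeg (J_ideal f H) = k"
    then obtain H where H: "H \<subseteq> curve_ders f" "\<And>\<theta>. \<theta> \<in> H \<Longrightarrow> \<exists>e. homogeneous_der e \<theta>"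
      "J_ideal f H \<noteq> {0}" "Indeg (J_ideal f H) = k" by blast
    \<comment> \<open>As 0 is in the ideal, differing from \<open>{0}\<close> means having a nonzero
      element, so the \<open>LEAST\<close> in \<open>Indeg\<close> is attained.\<close>
    have "0 \<in> J_ideal f H" unfolding J by (rule module.span_zero[OF module_mult])
    then have "\<exists>e. \<exists>p\<in>J_ideal f H. p \<noteq> 0 \<and> total_degree p = e" using H(3) by blast
    then have "\<exists>p\<in>J_ideal f H. p \<noteq> 0 \<and> total_degree p = k"
      unfolding H(4)[symmetric] Indeg_def by (rule LeastI_ex)
    then obtain p where p: "p \<in> module.span (*) (G H)" "p \<noteq> 0" "total_degree p = k"
      unfolding J by blast
    \<comment> \<open>Stated additively to avoid truncated subtraction of \<open>d\<close>.\<close>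
    have bound: "\<exists>n. homogeneous n g \<and> 1 + ds ! 1 + ds ! 2 \<le> n + d" if g: "g \<in> G H" "g \<noteq> 0" for g
    proof -
      obtain a b c where abc: "a \<in> H" "b \<in> H" "c \<in> H" and det: "det (der_matrix a b c) = g * f"
        using g(1) by (auto simp: G_def)
      obtain x y z where hom: "homogeneous_der x a" "homogeneous_der y b" "homogeneous_der z c"
        using H(2) abc by metis
      have "det (der_matrix a b c) \<noteq> 0" using det g(2) f_nonzero by simp
      then have le: "1 + ds ! 1 + ds ! 2 \<le> x + y + z"
        using abc H(1) hom by (intro degree_sum_ge) auto
      have "homogeneous (x + y + z) (g * f)"
        using homogeneous_det_der_matrix[OF hom] det by simp
      then obtain n where "x + y + z = n + d" "homogeneous n g"
        using homogeneous_f f_nonzero g(2) by (rule homogeneous_factor)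
      with le show ?thesis by auto
    qed
    \<comment> \<open>Truncation is harmless here: the integer-valued type never exceeds the
      truncated difference.\<close>
    have "1 + ds ! 1 + ds ! 2 - d \<le> total_degree p"
      using p(1,2)
    proof (rule total_degree_ge_if_in_span)
      fix g assume "g \<in> G H" "g \<noteq> 0"
      then obtain n where "homogeneous n g" "1 + ds ! 1 + ds ! 2 \<le> n + d" using bound by blast
      then show "\<exists>n\<ge>1 + ds ! 1 + ds ! 2 - d. homogeneous n g"
        by (intro exI[of _ n]) linarith
    qed
    then show "curve_type f ds \<le> int k"
      using p(3) by (simp add: curve_type_def d_def)
  qed
qed

end
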